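(* Let $n\ge1$, let $p=(p_{ij})_{1\le i,j\le 2n}$, $q=(q_{ij})_{1\le i,j\le 2n}$ satisfy the $(p,\lambda)$ condition, and let $R$ be a unital associative $\mathbb C$-algebra. Let $A=(a_{ij})_{1\le i,j\le 2n}$ be a $(p,\lambda)$-matrix with entries in $R$, and let $B=(b_{ij})_{1\le i,j\le 2n}$ be a $p$-antisymmetric matrix with (not necessarily commuting) entries in $R$, i.e. $b_{ji}=-p_{ij}b_{ij}$ for $i<j$ and $b_{ii}=0$. Assume that every entry of $B$ commutes with every entry of $A$. Let $C=(c_{ij})=A^{T}BA$. Then $$c_{ji}=-p_{ij}c_{ij}\quad\text{for } i<j,$$ and $$\mathrm{Pf}_q(C)={\det}_q(A)\,\mathrm{Pf}_q(B).$$
   Context: Parameters: $p$ and $q$ are $2n\times 2n$ matrices of complex numbers with $p_{ij}p_{ji}=1$, $p_{ii}=1$, $q_{ij}q_{ji}=1$, $q_{ii}=1$. The $(p,\lambda)$ condition: there is $\lambda\in\mathbb C$, $\lambda\ne -1$, with $p_{ij}q_{ij}=\lambda$ for all $i<j$. A $(p,\lambda)$-matrix is a matrix $A=(a_{ij})$ whose entries satisfy $$a_{ik}a_{il}=q_{kl}a_{il}a_{ik}\quad (k<l,\ \text{all } i),$$ $$a_{ik}a_{jk}=p_{ij}a_{jk}a_{ik}\quad (i<j,\ \text{all } k),$$ and, for $i<j$ and $k<l$, $$a_{ik}a_{jl}-\frac{q_{kl}}{q_{ij}}a_{jl}a_{ik}=q_{kl}a_{il}a_{jk}-\frac{1}{q_{ij}}a_{jk}a_{il},$$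 $$a_{ik}a_{jl}-\frac{p_{ij}}{p_{kl}}a_{jl}a_{ik}=p_{ij}a_{jk}a_{il}-\frac{1}{p_{kl}}a_{il}a_{jk}.$$ For $\sigma\in S_{2n}$ put $$(-q)_\sigma=(-1)^{l(\sigma)}\prod_{i<j,\ \sigma_i>\sigma_j}q_{\sigma_j\sigma_i},\qquad (-p)_\sigma=(-1)^{l(\sigma)}\prod_{i<j,\ \sigma_i>\sigma_j}p_{\sigma_j\sigma_i},$$ where $l(\sigma)$ is the number of inversions of $\sigma$. The quantum determinant is $${\det}_q(A)=\sum_{\sigma\in S_{2n}}(-q)_\sigma a_{1,\sigma_1}\cdots a_{2n,\sigma_{2n}}=\sum_{\sigma\in S_{2n}}(-p)_\sigma a_{\sigma_1,1}\cdots a_{\sigma_{2n},2n}$$ (the two expressions agree under the $(p,\lambda)$ condition). The multiparameter quantum Pfaffian of a $2n\times2n$ $p$-antisymmetric matrix $B=(b_{ij})$ is $$\mathrm{Pf}_q(B)=\sum_{\sigma\in\Pi}(-q)_\sigma\, b_{\sigma(1)\sigma(2)}b_{\sigma(3)\sigma(4)}\cdots b_{\sigma(2n-1)\sigma(2n)},$$ where $\Pi$ is the set of $\sigma\in S_{2n}$ with $\sigma(2i-1)<\sigma(2i)$ for $i=1,\dots,n$ (no ordering between different pairs is imposed, and there is no normalizing factor). *)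

theory Defs
  imports Complex_Main "HOL-Combinatorics.Permutations" "Jordan_Normal_Form.Matrix"
begin

text \<open>
  Matrices are indexed from \<open>0\<close>, so the indices \<open>1, \<dots>, m\<close> of the mathematical text
  become \<open>0, \<dots>, m - 1\<close>, and permutations of \<open>{1, \<dots>, m}\<close> become permutations of
  \<open>{0..<m}\<close>.
\<close>

text \<open>
  Unital associative algebras over the complex numbers, not necessarily commutative. The sort
  \<open>{ring, monoid_mult}\<close> is used in place of \<open>ring_1\<close> because the latter excludes the
  zero ring.
\<close>

class complex_algebra_unital = ring + monoid_mult +
  fixes scaleC :: "complex \<Rightarrow> 'a \<Rightarrow> 'a"  (infixr \<open>*\<^sub>C\<close> 75)
  assumes scaleC_add_right: "c *\<^sub>C (x + y) = c *\<^sub>C x + c *\<^sub>C y"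
    and scaleC_add_left: "(c + d) *\<^sub>C x = c *\<^sub>C x + d *\<^sub>C x"
    and scaleC_scaleC: "c *\<^sub>C d *\<^sub>C x = (c * d) *\<^sub>C x"
    and scaleC_one: "1 *\<^sub>C x = x"
    and mult_scaleC_left: "(c *\<^sub>C x) * y = c *\<^sub>C (x * y)"
    and mult_scaleC_right: "x * (c *\<^sub>C y) = c *\<^sub>C (x * y)"

instantiation complex :: complex_algebra_unital
begin

definition scaleC_complex :: "complex \<Rightarrow> complex \<Rightarrow> complex"
  where "scaleC_complex c x = c * x"

instance
  by standard (simp_all add: scaleC_complex_def algebra_simps)

end

definition parameter_matrix :: "nat \<Rightarrow> complex mat \<Rightarrow> bool" where
  "parameter_matrix m p \<longleftrightarrow>
     p \<in> carrier_mat m m \<and>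
     (\<forall>i<m. \<forall>j<m. p $$ (i, j) * p $$ (j, i) = 1) \<and>
     (\<forall>i<m. p $$ (i, i) = 1)"

definition p_lambda_condition :: "nat \<Rightarrow> complex mat \<Rightarrow> complex mat \<Rightarrow> bool" where
  "p_lambda_condition m p q \<longleftrightarrow>
     parameter_matrix m p \<and> parameter_matrix m q \<and>
     (\<exists>l. l \<noteq> -1 \<and> (\<forall>i j. i < j \<and> j < m \<longrightarrow> p $$ (i, j) * q $$ (i, j) = l))"

definition p_lambda_matrix ::
  "nat \<Rightarrow> complex mat \<Rightarrow> complex mat \<Rightarrow> 'r::complex_algebra_unital mat \<Rightarrow> bool" where
  "p_lambda_matrix m p q A \<longleftrightarrow>
     A \<in> carrier_mat m m \<and>
     (\<forall>i k l. i < m \<and> k < l \<and> l < m \<longrightarrow>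
        A $$ (i, k) * A $$ (i, l) = q $$ (k, l) *\<^sub>C (A $$ (i, l) * A $$ (i, k))) \<and>
     (\<forall>i j k. i < j \<and> j < m \<and> k < m \<longrightarrow>
        A $$ (i, k) * A $$ (j, k) = p $$ (i, j) *\<^sub>C (A $$ (j, k) * A $$ (i, k))) \<and>
     (\<forall>i j k l. i < j \<and> j < m \<and> k < l \<and> l < m \<longrightarrow>
        A $$ (i, k) * A $$ (j, l)
            - (q $$ (k, l) / q $$ (i, j)) *\<^sub>C (A $$ (j, l) * A $$ (i, k))
          = q $$ (k, l) *\<^sub>C (A $$ (i, l) * A $$ (j, k))
            - (1 / q $$ (i, j)) *\<^sub>C (A $$ (j, k) * A $$ (i, l))) \<and>
     (\<forall>i j k l. i < j \<and> j < m \<and> k < l \<and> l < m \<longrightarrow>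
        A $$ (i, k) * A $$ (j, l)
            - (p $$ (i, j) / p $$ (k, l)) *\<^sub>C (A $$ (j, l) * A $$ (i, k))
          = p $$ (i, j) *\<^sub>C (A $$ (j, k) * A $$ (i, l))
            - (1 / p $$ (k, l)) *\<^sub>C (A $$ (i, l) * A $$ (j, k)))"

definition p_antisymmetric ::
  "nat \<Rightarrow> complex mat \<Rightarrow> 'r::complex_algebra_unital mat \<Rightarrow> bool" where
  "p_antisymmetric m p B \<longleftrightarrow>
     B \<in> carrier_mat m m \<and>
     (\<forall>i j. i < j \<and> j < m \<longrightarrow> B $$ (j, i) = - (p $$ (i, j) *\<^sub>C B $$ (i, j))) \<and>
     (\<forall>i<m. B $$ (i, i) = 0)"

definition inversions :: "nat \<Rightarrow> (nat \<Rightarrow> nat) \<Rightarrow> (nat \<times> nat) set" where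
  "inversions m \<sigma> = {(i, j). i < j \<and> j < m \<and> \<sigma> i > \<sigma> j}"

text \<open>The scalar \<open>(-q)\<close> with subscript \<open>\<sigma>\<close>.\<close>

definition q_sign :: "nat \<Rightarrow> complex mat \<Rightarrow> (nat \<Rightarrow> nat) \<Rightarrow> complex" where
  "q_sign m q \<sigma> =
     (-1) ^ card (inversions m \<sigma>) * (\<Prod>(i, j)\<in>inversions m \<sigma>. q $$ (\<sigma> j, \<sigma> i))"

text \<open>
  The row expansion; under the \<open>(p, \<lambda>)\<close> condition it agrees with the column expansion
  weighted by \<open>q_sign m p\<close>. The factors do not commute, so their order, fixed here by
  \<open>prod_list\<close>, matters.
\<close>

definition det_q :: "nat \<Rightarrow> complex mat \<Rightarrow> 'r::complex_algebra_unital mat \<Rightarrow> 'r" where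
  "det_q m q A =
     (\<Sum>\<sigma> | \<sigma> permutes {0..<m}.
        q_sign m q \<sigma> *\<^sub>C prod_list (map (\<lambda>i. A $$ (i, \<sigma> i)) [0..<m]))"

text \<open>
  With indices from \<open>0\<close>, the pair \<open>(\<sigma>(2i-1), \<sigma>(2i))\<close> for \<open>1 \<le> i \<le> n\<close> becomes
  \<open>(\<sigma> (2 * i), \<sigma> (2 * i + 1))\<close> for \<open>i < n\<close>.
\<close>

definition pfaffian_perms :: "nat \<Rightarrow> (nat \<Rightarrow> nat) set" where
  "pfaffian_perms n =
     {\<sigma>. \<sigma> permutes {0..<2 * n} \<and> (\<forall>i<n. \<sigma> (2 * i) < \<sigma> (2 * i + 1))}"

definition pf_q :: "nat \<Rightarrow> complex mat \<Rightarrow> 'r::complex_algebra_unital mat \<Rightarrow> 'r" where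
  "pf_q n q B =
     (\<Sum>\<sigma>\<in>pfaffian_perms n.
        q_sign (2 * n) q \<sigma> *\<^sub>C
          prod_list (map (\<lambda>i. B $$ (\<sigma> (2 * i), \<sigma> (2 * i + 1))) [0..<n]))"

end

theory Submission
  imports Defs
begin

text \<open>
  The proof is a computation in the quantum exterior algebra, which has generators
  \<open>x\<^sub>i\<close> commuting with the entries of \<open>A\<close> and \<open>B\<close> and the relations
  \<open>x\<^sub>i x\<^sub>i = 0\<close> and \<open>x\<^sub>j x\<^sub>i = - q\<^sub>i\<^sub>j x\<^sub>i x\<^sub>j\<close> for \<open>i < j\<close>. Its top degree is spanned
  by the product of all the \<open>x\<^sub>i\<close> in increasing order. The coefficient on this product is \<open>det_q A\<close> for
  the ordered product of the linear forms \<open>y\<^sub>k = \<Sum>\<^sub>i a\<^sub>k\<^sub>i x\<^sub>i\<close>, and it is \<open>pf_q B\<close> for the \<open>n\<close>-th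
  power of the quadratic form \<open>\<Sum>\<^sub>i\<^sub><\<^sub>j b\<^sub>i\<^sub>j x\<^sub>i x\<^sub>j\<close>. By \<open>p\<close>-antisymmetry and
  \<open>p\<^sub>i\<^sub>j q\<^sub>i\<^sub>j = \<lambda>\<close>, the sum \<open>\<Sum>\<^sub>i\<^sub>,\<^sub>j b\<^sub>i\<^sub>j x\<^sub>i x\<^sub>j\<close> over all pairs is
  \<open>1 + \<lambda>\<close> times that form (\<open>form_power_upper_half\<close>).

  Two facts combine. Since \<open>C = A\<^sup>T B A\<close> and the entries of \<open>A\<close> and \<open>B\<close> commute, substitution gives
  \<open>\<Sum> c\<^sub>i\<^sub>j x\<^sub>i x\<^sub>j = \<Sum> b\<^sub>k\<^sub>l y\<^sub>k y\<^sub>l\<close> (\<open>form_power_congruence\<close>). And the relations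
  between the entries of \<open>A\<close> say that the \<open>y\<^sub>k\<close> satisfy the same exterior relations as the \<open>x\<^sub>i\<close>
  (\<open>alternating_rows\<close>), so that a product of \<open>m\<close> of the \<open>y\<^sub>k\<close> reorders with the same
  sign as the corresponding product of the \<open>x\<^sub>k\<close> (\<open>alternating_top\<close>). Hence
  \<open>(1 + \<lambda>)\<^sup>n pf_q C = det_q A (1 + \<lambda>)\<^sup>n pf_q B\<close>, and \<open>1 + \<lambda>\<close> is invertible.

  The algebra itself is not constructed. An element is seen only through linear functionals, and a
  functional is recorded by its values on the monomials, that is, by a function on words in the indices.
  Such a function comes from the exterior algebra exactly if it is \<open>alternating\<close>. The functional
  used at the end is \<open>word_sign\<close>, which in the top degree is the coefficient meant above.
\<close>

section \<open>Scalar multiplication and square sums\<close>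

interpretation scaleC: Modules.module "scaleC :: complex \<Rightarrow> 'r::complex_algebra_unital \<Rightarrow> 'r"
  by standard (simp_all add: scaleC_add_right scaleC_add_left scaleC_scaleC scaleC_one)

lemma scaleC_cancel:
  assumes "c *\<^sub>C x = c *\<^sub>C y" "c \<noteq> 0"
  shows "x = y"
  using arg_cong[OF assms(1), of "\<lambda>z. inverse c *\<^sub>C z"] assms(2)
  by (simp add: scaleC_scaleC scaleC_one)

lemma sum_square_split:
  fixes F :: "nat \<Rightarrow> nat \<Rightarrow> 'a::comm_monoid_add"
  shows "(\<Sum>i<m. \<Sum>j<m. F i j) = (\<Sum>j<m. F j j) + (\<Sum>j<m. \<Sum>i<j. F i j + F j i)"
  by (induction m) (simp_all add: sum.distrib ac_simps)

section \<open>Alternating functionals on words\<close>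

text \<open>
  The relations may be applied at any place in a word, so this says that \<open>g\<close>, extended linearly to the
  free algebra, vanishes on the two-sided ideal of relations of the quantum exterior algebra.
\<close>

definition alternating ::
  "nat \<Rightarrow> (nat \<Rightarrow> nat \<Rightarrow> complex) \<Rightarrow> (nat list \<Rightarrow> 'r::complex_algebra_unital) \<Rightarrow> bool" where
  "alternating m q g \<longleftrightarrow>
     (\<forall>u v i j. i < j \<and> j < m \<longrightarrow> g (u @ j # i # v) = - (q i j *\<^sub>C g (u @ i # j # v))) \<and>
     (\<forall>u v i. i < m \<longrightarrow> g (u @ i # i # v) = 0)"

lemma alternating_swap:
  "alternating m q g \<Longrightarrow> i < j \<Longrightarrow> j < m \<Longrightarrow> g (u @ j # i # v) = - (q i j *\<^sub>C g (u @ i # j # v))"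
  by (auto simp: alternating_def)

lemma alternating_repeat:
  "alternating m q g \<Longrightarrow> i < m \<Longrightarrow> g (u @ i # i # v) = 0"
  by (auto simp: alternating_def)

text \<open>
  Collecting a quadratic form \<open>\<Sum> f\<^sub>i\<^sub>j x\<^sub>i x\<^sub>j\<close> on the ordered monomials: its coefficient at \<open>x\<^sub>i x\<^sub>j\<close>
  with \<open>i < j\<close> is \<open>f\<^sub>i\<^sub>j - q\<^sub>i\<^sub>j f\<^sub>j\<^sub>i\<close>. Both the exterior relations between the rows of a matrix and the
  factor \<open>1 + \<lambda>\<close> come from this formula.
\<close>

lemma alternating_pair_sum:
  assumes "alternating m q g"
  shows "(\<Sum>i<m. \<Sum>j<m. f i j * g (u @ [i, j])) =
         (\<Sum>j<m. \<Sum>i<j. (f i j - q i j *\<^sub>C f j i) * g (u @ [i, j]))"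
proof -
  have "f i j * g (u @ [i, j]) + f j i * g (u @ [j, i])
      = (f i j - q i j *\<^sub>C f j i) * g (u @ [i, j])" if "i < j" "j < m" for i j
    using alternating_swap[OF assms that, of u "[]"]
    by (simp add: left_diff_distrib mult_scaleC_left mult_scaleC_right)
  moreover have "f j j * g (u @ [j, j]) = 0" if "j < m" for j
    using alternating_repeat[OF assms that, of u "[]"] by simp
  ultimately show ?thesis
    by (simp add: sum_square_split)
qed

text \<open>
  The factor picked up by moving \<open>x\<close> from the left of \<open>y\<close> to its sorted position. The value \<open>0\<close> for
  equal letters makes \<open>word_sign\<close> vanish on words with a repetition without a case distinction.
\<close>

definition crossing :: "(nat \<Rightarrow> nat \<Rightarrow> complex) \<Rightarrow> nat \<Rightarrow> nat \<Rightarrow> complex" where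
  "crossing q x y = (if y < x then - q y x else if y = x then 0 else 1)"

primrec word_sign :: "(nat \<Rightarrow> nat \<Rightarrow> complex) \<Rightarrow> nat list \<Rightarrow> complex" where
  "word_sign q [] = 1"
| "word_sign q (x # w) = (\<Prod>y\<leftarrow>w. crossing q x y) * word_sign q w"

lemma word_sign_swap:
  "i < j \<Longrightarrow> word_sign q (u @ j # i # v) = - q i j * word_sign q (u @ i # j # v)"
  by (induction u) (simp_all add: crossing_def)

lemma word_sign_repeat: "word_sign q (u @ i # i # v) = 0"
  by (induction u) (simp_all add: crossing_def)

lemma alternating_word_sign:
  "alternating m q (\<lambda>w. word_sign q w *\<^sub>C (1 :: 'r::complex_algebra_unital))"
  by (simp add: alternating_def word_sign_swap word_sign_repeat scaleC_scaleC)

lemma word_sign_not_distinct: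
  assumes "\<not> distinct w"
  shows "word_sign q w = 0"
  using assms by (induction w) (auto simp: prod_list_zero_iff crossing_def)

text \<open>
  Insertion sort computes normal forms in the exterior algebra: moving one letter into a sorted
  word costs one crossing factor per letter. A letter beyond its insertion point contributes \<open>1\<close>, so the
  product may run over the whole word.
\<close>

lemma alternating_insort:
  assumes "alternating m q g" "x < m" "set s \<subseteq> {..<m}" "sorted s"
  shows "g (u @ x # s) = (\<Prod>y\<leftarrow>s. crossing q x y) *\<^sub>C g (u @ insort x s)"
  using assms(3,4)
proof (induction s arbitrary: u)
  case Nil
  then show ?case by (simp add: scaleC_one)
next
  case (Cons y s)
  consider "x < y" | "x = y" | "y < x" by linarith
  then show ?case
  proof cases
    case 1
    then have "crossing q x z = 1" if "z \<in> set (y # s)" for z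
      using Cons.prems that by (auto simp: crossing_def)
    then have "(\<Prod>z\<leftarrow>y # s. crossing q x z) = 1"
      unfolding prod.list_conv_set_nth by (intro prod.neutral) (simp del: list.map list.set nth_Cons_Suc)
    with 1 show ?thesis by (simp add: scaleC_one)
  next
    case 2
    then show ?thesis
      using alternating_repeat[OF assms(1,2)] by (simp add: crossing_def)
  next
    case 3
    have "g (u @ x # y # s) = - (q y x *\<^sub>C g ((u @ [y]) @ x # s))"
      using alternating_swap[OF assms(1) 3 assms(2)] by simp
    also have "\<dots> = - (q y x *\<^sub>C (\<Prod>y\<leftarrow>s. crossing q x y) *\<^sub>C g ((u @ [y]) @ insort x s))"
      using Cons by (subst Cons.IH) auto
    finally show ?thesis
      using 3 by (simp add: crossing_def scaleC_scaleC)
  qed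
qed

lemma alternating_sort:
  assumes "alternating m q g" "set w \<subseteq> {..<m}"
  shows "g (u @ w) = word_sign q w *\<^sub>C g (u @ sort w)"
  using assms(2)
proof (induction w arbitrary: u)
  case Nil
  then show ?case by (simp add: scaleC_one)
next
  case (Cons x w)
  have "g (u @ x # w) = word_sign q w *\<^sub>C g (u @ x # sort w)"
    using Cons.IH[of "u @ [x]"] Cons.prems by simp
  also have "g (u @ x # sort w) = (\<Prod>y\<leftarrow>sort w. crossing q x y) *\<^sub>C g (u @ insort x (sort w))"
    using Cons.prems by (intro alternating_insort[OF assms(1)]) auto
  also have "(\<Prod>y\<leftarrow>sort w. crossing q x y) = (\<Prod>y\<leftarrow>w. crossing q x y)"
    by (metis mset_map mset_sort prod_mset_prod_list)
  finally show ?case by (simp add: scaleC_scaleC mult.commute)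
qed

text \<open>
  The top degree of the exterior algebra is one-dimensional: the only sorted word of length \<open>m\<close> without
  repetition is \<open>[0..<m]\<close>, so an alternating functional is determined there by a single value.
\<close>

lemma alternating_top:
  assumes "alternating m q g" "set w \<subseteq> {..<m}" "length w = m"
  shows "g w = word_sign q w *\<^sub>C g [0..<m]"
proof (cases "distinct w")
  case True
  with assms have "set w = {..<m}"
    by (intro card_subset_eq) (simp_all add: distinct_card)
  with True have "sort w = [0..<m]"
    by (intro sorted_distinct_set_unique[of "sort w"]) (simp_all add: atLeast0LessThan)
  then show ?thesis
    using alternating_sort[OF assms(1,2), of "[]"] by simp
next
  case False
  then show ?thesis
    using alternating_sort[OF assms(1,2), of "[]"] by (simp add: word_sign_not_distinct)
qed

section \<open>Words and permutations\<close>

abbreviation words :: "nat \<Rightarrow> nat \<Rightarrow> nat list set" where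
  "words m k \<equiv> {w. set w \<subseteq> {..<m} \<and> length w = k}"

lemma sum_words_Suc:
  "(\<Sum>w\<in>words m (Suc k). f w) = (\<Sum>i<m. \<Sum>w\<in>words m k. f (i # w))"
proof -
  have "words m (Suc k) = (\<lambda>(i, w). i # w) ` ({..<m} \<times> words m k)"
    by (auto simp: length_Suc_conv image_iff)
  moreover have "inj_on (\<lambda>(i, w). i # w) ({..<m} \<times> words m k)"
    by (auto simp: inj_on_def)
  ultimately show ?thesis
    by (simp add: sum.reindex sum.cartesian_product case_prod_unfold)
qed

lemma word_sign_prod_positions:
  "word_sign q w = (\<Prod>i<length w. \<Prod>j\<in>{i<..<length w}. crossing q (w ! i) (w ! j))"
proof (induction w)
  case (Cons x w)
  have "(\<Prod>j\<in>{0<..<Suc (length w)}. crossing q x ((x # w) ! j)) = (\<Prod>y\<leftarrow>w. crossing q x y)"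
  proof -
    have "{0<..<Suc (length w)} = Suc ` {..<length w}"
      by (auto simp: image_iff gr0_conv_Suc)
    then show ?thesis
      by (simp add: prod.reindex prod.list_conv_set_nth atLeast0LessThan)
  qed
  moreover have "(\<Prod>j\<in>{Suc i<..<Suc (length w)}. crossing q (w ! i) ((x # w) ! j))
      = (\<Prod>j\<in>{i<..<length w}. crossing q (w ! i) (w ! j))" for i
  proof -
    have "{Suc i<..<Suc (length w)} = Suc ` {i<..<length w}"
      by (auto simp: image_iff Suc_less_eq2 less_Suc_eq_0_disj)
    then show ?thesis by (simp add: prod.reindex)
  qed
  ultimately show ?case
    by (simp add: Cons.IH prod.lessThan_Suc_shift del: prod.lessThan_Suc)
qed simp

text \<open>
  Only the inversions of \<open>\<sigma>\<close> contribute a crossing factor other than \<open>1\<close>, because \<open>\<sigma>\<close> is injective,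
  and each of them contributes one sign and one entry of \<open>q\<close>.
\<close>

lemma word_sign_permutation:
  assumes "\<sigma> permutes {0..<m}"
  shows "word_sign (\<lambda>i j. q $$ (i, j)) (map \<sigma> [0..<m]) = q_sign m q \<sigma>"
proof -
  let ?c = "\<lambda>i j. crossing (\<lambda>i j. q $$ (i, j)) (\<sigma> i) (\<sigma> j)"
  let ?P = "SIGMA i:{..<m}. {i<..<m}"
  have sub: "inversions m \<sigma> \<subseteq> ?P" and fin: "finite ?P"
    by (auto simp: inversions_def)
  have "word_sign (\<lambda>i j. q $$ (i, j)) (map \<sigma> [0..<m]) = (\<Prod>i<m. \<Prod>j\<in>{i<..<m}. ?c i j)"
    by (simp add: word_sign_prod_positions)
  also have "\<dots> = (\<Prod>(i, j)\<in>?P. ?c i j)"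
    by (simp add: prod.Sigma)
  also have "\<dots> = (\<Prod>(i, j)\<in>inversions m \<sigma>. ?c i j)"
  proof (rule prod.mono_neutral_right[OF fin sub])
    have "?c i j = 1" if "i < j" "j < m" "(i, j) \<notin> inversions m \<sigma>" for i j
      using that permutes_inj[OF assms] by (auto simp: crossing_def inversions_def dest: injD)
    then show "\<forall>x\<in>?P - inversions m \<sigma>. (case x of (i, j) \<Rightarrow> ?c i j) = 1"
      by auto
  qed
  also have "\<dots> = (\<Prod>(i, j)\<in>inversions m \<sigma>. (- 1) * q $$ (\<sigma> j, \<sigma> i))"
    by (rule prod.cong) (auto simp: crossing_def inversions_def)
  also have "\<dots> = q_sign m q \<sigma>"
    unfolding q_sign_def case_prod_unfold by (subst prod.distrib) simp
  finally show ?thesis .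
qed

lemma bij_betw_permutations_words:
  "bij_betw (\<lambda>\<sigma>. map \<sigma> [0..<m]) {\<sigma>. \<sigma> permutes {0..<m}} {w \<in> words m m. distinct w}"
proof (rule bij_betw_imageI)
  show "inj_on (\<lambda>\<sigma>. map \<sigma> [0..<m]) {\<sigma>. \<sigma> permutes {0..<m}}"
  proof (rule inj_onI, rule ext)
    fix \<sigma> \<tau> x
    assume *: "\<sigma> \<in> {\<sigma>. \<sigma> permutes {0..<m}}" "\<tau> \<in> {\<sigma>. \<sigma> permutes {0..<m}}"
      "map \<sigma> [0..<m] = map \<tau> [0..<m]"
    show "\<sigma> x = \<tau> x"
      using * by (cases "x < m") (auto simp: permutes_def)
  qed
  have "map \<sigma> [0..<m] \<in> {w \<in> words m m. distinct w}" if "\<sigma> permutes {0..<m}" for \<sigma>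
  proof -
    have "\<sigma> ` {0..<m} \<subseteq> {..<m}"
      using permutes_image[OF that] by auto
    then show ?thesis
      using permutes_inj_on[OF that] by (simp add: distinct_map)
  qed
  moreover have "w \<in> (\<lambda>\<sigma>. map \<sigma> [0..<m]) ` {\<sigma>. \<sigma> permutes {0..<m}}"
    if w: "w \<in> words m m" "distinct w" for w
  proof
    define \<sigma> where "\<sigma> = (\<lambda>i. if i < m then w ! i else i)"
    have "set w = {0..<m}"
      using w by (intro card_subset_eq) (auto simp: distinct_card)
    then have "bij_betw ((!) w) {0..<m} {0..<m}"
      using w bij_betw_nth[of w "{0..<m}" "{0..<m}"] by (simp add: atLeast0LessThan)
    then have "bij_betw \<sigma> {0..<m} {0..<m}"
      by (subst bij_betw_cong[of _ _ "(!) w"]) (auto simp: \<sigma>_def)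
    then show "\<sigma> \<in> {\<sigma>. \<sigma> permutes {0..<m}}"
      by (auto simp: \<sigma>_def intro: bij_imp_permutes)
    show "w = map \<sigma> [0..<m]"
      using w by (auto simp: \<sigma>_def intro: nth_equalityI)
  qed
  ultimately show "(\<lambda>\<sigma>. map \<sigma> [0..<m]) ` {\<sigma>. \<sigma> permutes {0..<m}} = {w \<in> words m m. distinct w}"
    by auto
qed

text \<open>
  Words with a repeated letter have sign \<open>0\<close>, and the other words of length \<open>m\<close> are the permutations.
  This turns sums over all words, which multilinear expansion produces, into the sums over permutations
  by which the determinant and the Pfaffian are defined.
\<close>

lemma sum_words_eq_sum_permutations:
  fixes F :: "nat list \<Rightarrow> 'r::complex_algebra_unital"
  shows "(\<Sum>w\<in>words m m. word_sign (\<lambda>i j. q $$ (i, j)) w *\<^sub>C F w) =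
         (\<Sum>\<sigma> | \<sigma> permutes {0..<m}. q_sign m q \<sigma> *\<^sub>C F (map \<sigma> [0..<m]))"
proof -
  let ?G = "\<lambda>w. word_sign (\<lambda>i j. q $$ (i, j)) w *\<^sub>C F w"
  have "(\<Sum>w\<in>words m m. ?G w) = (\<Sum>w\<in>{w \<in> words m m. distinct w}. ?G w)"
    by (rule sum.mono_neutral_right) (auto simp: word_sign_not_distinct finite_lists_length_eq)
  also have "\<dots> = (\<Sum>\<sigma> | \<sigma> permutes {0..<m}. ?G (map \<sigma> [0..<m]))"
    by (rule sum.reindex_bij_betw[OF bij_betw_permutations_words, symmetric])
  also have "\<dots> = (\<Sum>\<sigma> | \<sigma> permutes {0..<m}. q_sign m q \<sigma> *\<^sub>C F (map \<sigma> [0..<m]))"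
    by (rule sum.cong) (auto simp: word_sign_permutation)
  finally show ?thesis .
qed

section \<open>Products of linear forms\<close>

text \<open>
  The value of the functional \<open>g\<close> on \<open>x\<^sub>u y\<^sub>v\<close>, where \<open>x\<^sub>u\<close> is the monomial of the word \<open>u\<close> and \<open>y\<^sub>v\<close> the
  product, in the order of the word \<open>v\<close>, of the linear forms \<open>y\<^sub>k = \<Sum>\<^sub>i a\<^sub>k\<^sub>i x\<^sub>i\<close>. The prefix \<open>u\<close> carries
  the letters already chosen while the product is expanded.
\<close>

primrec row_product ::
  "nat \<Rightarrow> (nat \<Rightarrow> nat \<Rightarrow> 'r::complex_algebra_unital) \<Rightarrow> (nat list \<Rightarrow> 'r) \<Rightarrow>
   nat list \<Rightarrow> nat list \<Rightarrow> 'r" where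
  "row_product m a g [] u = g u"
| "row_product m a g (k # v) u = (\<Sum>i<m. a k i * row_product m a g v (u @ [i]))"

lemma row_product_append:
  "row_product m a g (v @ v') u = row_product m a (row_product m a g v') v u"
  by (induction v arbitrary: u) simp_all

lemma row_product_scaleC:
  "row_product m a (\<lambda>s. c *\<^sub>C g s) v u = c *\<^sub>C row_product m a g v u"
  by (induction v arbitrary: u) (simp_all add: mult_scaleC_right scaleC.scale_sum_right)

lemma row_product_sum:
  "row_product m a (\<lambda>s. \<Sum>x\<in>X. g x s) v u = (\<Sum>x\<in>X. row_product m a (g x) v u)"
proof (induction v arbitrary: u)
  case (Cons k v)
  then show ?case by (simp add: sum_distrib_left) (rule sum.swap)
qed simp

lemma row_product_commute:
  assumes "\<And>k i. k < m \<Longrightarrow> i < m \<Longrightarrow> b * a k i = a k i * b" "set v \<subseteq> {..<m}"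
  shows "row_product m a (\<lambda>s. b * g s) v u = b * row_product m a g v u"
  using assms(2)
proof (induction v arbitrary: u)
  case (Cons k v)
  have "a k i * (b * r) = b * (a k i * r)" if "i < m" for i r
    using assms(1)[of k i] Cons.prems that by (simp flip: mult.assoc)
  with Cons show ?case by (simp add: sum_distrib_left)
qed simp

lemma alternating_row_product:
  assumes "alternating m q g"
  shows "alternating m q (row_product m a g v)"
proof (induction v)
  case Nil
  then show ?case using assms by (simp add: alternating_def)
next
  case (Cons k v)
  have "a k r * row_product m a g v (u @ j # i # w @ [r])
      = - (q i j *\<^sub>C (a k r * row_product m a g v (u @ i # j # w @ [r])))"
    if "i < j" "j < m" for u w i j r
    using alternating_swap[OF Cons that, of u "w @ [r]"] by (simp add: mult_scaleC_right)
  then show ?case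
    by (simp add: alternating_def alternating_repeat[OF Cons] sum_negf scaleC.scale_sum_right)
qed

text \<open>
  The exterior relation \<open>y\<^sub>l y\<^sub>k = - q\<^sub>k\<^sub>l y\<^sub>k y\<^sub>l\<close>. Comparing coefficients at \<open>x\<^sub>i x\<^sub>j\<close> reduces it to the
  first four-term relation of a \<open>(p, \<lambda>)\<close>-matrix, multiplied by \<open>q\<^sub>k\<^sub>l\<close>.
\<close>

lemma row_pair_swap:
  assumes alt: "alternating m q g"
    and cross: "\<And>i j. i < j \<Longrightarrow> j < m \<Longrightarrow>
      a k i * a l j - (q i j / q k l) *\<^sub>C (a l j * a k i)
        = q i j *\<^sub>C (a k j * a l i) - (1 / q k l) *\<^sub>C (a l i * a k j)"
    and nz: "q k l \<noteq> 0"
  shows "row_product m a g [l, k] u = (- q k l) *\<^sub>C row_product m a g [k, l] u"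
proof -
  have coeff: "a l i * a k j - q i j *\<^sub>C (a l j * a k i)
      = (- q k l) *\<^sub>C (a k i * a l j - q i j *\<^sub>C (a k j * a l i))" if "i < j" "j < m" for i j
    using arg_cong[OF cross[OF that], of "\<lambda>x. q k l *\<^sub>C x"] nz
    by (simp add: scaleC.scale_right_diff_distrib scaleC_scaleC scaleC_one algebra_simps)
  have expand: "row_product m a g [k, l] u
      = (\<Sum>j<m. \<Sum>i<j. (a k i * a l j - q i j *\<^sub>C (a k j * a l i)) * g (u @ [i, j]))" for k l
    using alternating_pair_sum[OF alt, of "\<lambda>i j. a k i * a l j" u]
    by (simp add: sum_distrib_left mult.assoc)
  show ?thesis
    unfolding expand scaleC.scale_sum_right
    by (intro sum.cong refl) (simp add: coeff mult_scaleC_left)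
qed

text \<open>
  The exterior relation \<open>y\<^sub>k y\<^sub>k = 0\<close>, whose coefficients vanish by the relation inside row \<open>k\<close>.
\<close>

lemma row_pair_repeat:
  assumes alt: "alternating m q g"
    and row: "\<And>i j. i < j \<Longrightarrow> j < m \<Longrightarrow> a k i * a k j = q i j *\<^sub>C (a k j * a k i)"
  shows "row_product m a g [k, k] u = 0"
  using alternating_pair_sum[OF alt, of "\<lambda>i j. a k i * a k j" u] row
  by (simp add: sum_distrib_left mult.assoc)

text \<open>
  The preceding two relations hold inside any product: the linear forms to the right of the pair are
  absorbed into the functional, which stays alternating, and those to the left act linearly on it.
\<close>

lemma alternating_rows:
  assumes alt: "alternating m q g"
    and row: "\<And>k i j. k < m \<Longrightarrow> i < j \<Longrightarrow> j < m \<Longrightarrow> a k i * a k j = q i j *\<^sub>C (a k j * a k i)"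
    and cross: "\<And>k l i j. k < l \<Longrightarrow> l < m \<Longrightarrow> i < j \<Longrightarrow> j < m \<Longrightarrow>
      a k i * a l j - (q i j / q k l) *\<^sub>C (a l j * a k i)
        = q i j *\<^sub>C (a k j * a l i) - (1 / q k l) *\<^sub>C (a l i * a k j)"
    and nz: "\<And>k l. k < l \<Longrightarrow> l < m \<Longrightarrow> q k l \<noteq> 0"
  shows "alternating m q (\<lambda>v. row_product m a g v u)"
proof -
  have split: "row_product m a g (v @ x # y # v') u
      = row_product m a (row_product m a (row_product m a g v') [x, y]) v u" for v v' x y
  proof -
    have "row_product m a g (x # y # v') = row_product m a (row_product m a g v') [x, y]"
      using row_product_append[of m a g "[x, y]" v'] by (auto simp del: row_product.simps)
    then show ?thesis by (simp only: row_product_append)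
  qed
  note alt' = alternating_row_product[OF alt]
  have "row_product m a g (v @ l # k # v') u = - (q k l *\<^sub>C row_product m a g (v @ k # l # v') u)"
    if "k < l" "l < m" for k l v v'
  proof -
    have swap: "row_product m a (row_product m a g v') [l, k]
        = (\<lambda>s. (- q k l) *\<^sub>C row_product m a (row_product m a g v') [k, l] s)"
      using row_pair_swap[OF alt' cross[OF that] nz[OF that]] by blast
    show ?thesis
      unfolding split swap row_product_scaleC by (rule scaleC.scale_minus_left)
  qed
  moreover have "row_product m a g (v @ k # k # v') u = 0" if "k < m" for k v v'
  proof -
    have vanish: "row_product m a (row_product m a g v') [k, k] = (\<lambda>s. 0 *\<^sub>C (0 :: 'a))"
      using row_pair_repeat[where a = a, OF alt' row[OF that]] by (simp add: fun_eq_iff)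
    show ?thesis
      unfolding split vanish row_product_scaleC by (rule scaleC.scale_zero_left)
  qed
  ultimately show ?thesis by (simp add: alternating_def)
qed

lemma row_product_eq_sum_words:
  "row_product m a g v u
     = (\<Sum>w\<in>words m (length v). prod_list (map2 a v w) * g (u @ w))"
proof (induction v arbitrary: u)
  case Nil
  have "words m 0 = {[]}" by auto
  then show ?case by simp
next
  case (Cons k v)
  then show ?case
    by (simp add: sum_words_Suc sum_distrib_left mult.assoc)
qed

lemma det_q_eq_row_product:
  "det_q m q A = row_product m (\<lambda>i j. A $$ (i, j))
     (\<lambda>w. word_sign (\<lambda>i j. q $$ (i, j)) w *\<^sub>C 1) [0..<m] []"
proof -
  have "map2 (\<lambda>i j. A $$ (i, j)) [0..<m] (map \<sigma> [0..<m]) = map (\<lambda>i. A $$ (i, \<sigma> i)) [0..<m]" for \<sigma>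
    by (intro nth_equalityI) simp_all
  then show ?thesis
    by (simp add: row_product_eq_sum_words mult_scaleC_right sum_words_eq_sum_permutations det_q_def)
qed

lemma row_product_mult_right:
  "row_product m a (\<lambda>s. g s * b) v u = row_product m a g v u * b"
  by (induction v arbitrary: u) (simp_all add: sum_distrib_right mult.assoc)

lemma det_q_commute:
  assumes "\<And>k i. k < m \<Longrightarrow> i < m \<Longrightarrow> b * A $$ (k, i) = A $$ (k, i) * b"
  shows "b * det_q m q A = det_q m q A * b"
proof -
  have "b * det_q m q A = row_product m (\<lambda>i j. A $$ (i, j))
      (\<lambda>w. b * word_sign (\<lambda>i j. q $$ (i, j)) w *\<^sub>C 1) [0..<m] []"
    unfolding det_q_eq_row_product by (rule row_product_commute[symmetric]) (auto simp: assms)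
  also have "\<dots> = det_q m q A * b"
    unfolding det_q_eq_row_product row_product_mult_right[symmetric]
    by (simp add: mult_scaleC_left mult_scaleC_right)
  finally show ?thesis .
qed

section \<open>Powers of quadratic forms\<close>

text \<open>
  The value of the functional \<open>g\<close> on \<open>x\<^sub>u \<omega>\<^sup>n\<close>, where \<open>\<omega>\<close> is the quadratic form \<open>\<Sum>\<^sub>i\<^sub>,\<^sub>j b\<^sub>i\<^sub>j x\<^sub>i x\<^sub>j\<close>. The
  coefficients of the first factor come out leftmost, which fixes the order of the entries
  of \<open>b\<close>, as these need not commute with one another.
\<close>

primrec form_power ::
  "nat \<Rightarrow> (nat \<Rightarrow> nat \<Rightarrow> 'r::complex_algebra_unital) \<Rightarrow> (nat list \<Rightarrow> 'r) \<Rightarrow>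
   nat \<Rightarrow> nat list \<Rightarrow> 'r" where
  "form_power m b g 0 u = g u"
| "form_power m b g (Suc n) u = (\<Sum>i<m. \<Sum>j<m. b i j * form_power m b g n (u @ [i, j]))"

lemma alternating_form_power:
  assumes "alternating m q g"
  shows "alternating m q (form_power m b g n)"
proof (induction n)
  case 0
  then show ?case using assms by (simp add: alternating_def)
next
  case (Suc n)
  have "b k l * form_power m b g n (u @ j # i # v @ [k, l])
      = - (q i j *\<^sub>C (b k l * form_power m b g n (u @ i # j # v @ [k, l])))"
    if "i < j" "j < m" for u v i j k l
    using alternating_swap[OF Suc that, of u "v @ [k, l]"] by (simp add: mult_scaleC_right)
  then show ?case
    by (simp add: alternating_def alternating_repeat[OF Suc] sum_negf scaleC.scale_sum_right)
qed

lemma form_power_eq_sum_words: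
  "form_power m b g n u
     = (\<Sum>w\<in>words m (2 * n). (\<Prod>r\<leftarrow>[0..<n]. b (w ! (2 * r)) (w ! (2 * r + 1))) * g (u @ w))"
proof (induction n arbitrary: u)
  case 0
  have "words m 0 = {[]}" by auto
  then show ?case by simp
next
  case (Suc n)
  have shift: "(\<Prod>r\<leftarrow>[0..<Suc n]. b ((i # j # w) ! (2 * r)) ((i # j # w) ! (2 * r + 1)))
      = b i j * (\<Prod>r\<leftarrow>[0..<n]. b (w ! (2 * r)) (w ! (2 * r + 1)))" for i j w
    by (simp add: upt_conv_Cons map_Suc_upt[symmetric] o_def del: upt_Suc)
  have len: "2 * Suc n = Suc (Suc (2 * n))" by simp
  show ?case
    unfolding form_power.simps Suc.IH len sum_words_Suc shift
    by (simp add: sum_distrib_left mult.assoc)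
qed

lemma form_power_cong:
  assumes "\<And>w. set w \<subseteq> {..<m} \<Longrightarrow> length w = 2 * n \<Longrightarrow> g (u @ w) = h (u @ w)"
  shows "form_power m b g n u = form_power m b h n u"
  unfolding form_power_eq_sum_words by (rule sum.cong) (auto simp: assms)

lemma form_power_mult_left:
  assumes "\<And>i j. i < m \<Longrightarrow> j < m \<Longrightarrow> b i j * d = d * b i j"
  shows "form_power m b (\<lambda>v. d * g v) n u = d * form_power m b g n u"
proof (induction n arbitrary: u)
  case (Suc n)
  have "b i j * (d * r) = d * (b i j * r)" if "i < m" "j < m" for i j r
    using assms[OF that] by (simp flip: mult.assoc)
  with Suc show ?case by (simp add: sum_distrib_left)
qed simp

text \<open>
  The term of \<open>\<omega>\<close> at the pair \<open>(j, i)\<close> with \<open>i < j\<close> is \<open>(- p\<^sub>i\<^sub>j b\<^sub>i\<^sub>j) (- q\<^sub>i\<^sub>j x\<^sub>i x\<^sub>j)\<close>, that is, \<open>p\<^sub>i\<^sub>j q\<^sub>i\<^sub>j\<close>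
  times the term at \<open>(i, j)\<close>. So each factor \<open>\<omega>\<close> is \<open>1 + c\<close> times its upper triangular half.
\<close>

lemma form_power_upper_half:
  assumes alt: "alternating m q g"
    and anti: "\<And>i j. i < j \<Longrightarrow> j < m \<Longrightarrow> b j i = - (p i j *\<^sub>C b i j)"
    and pq: "\<And>i j. i < j \<Longrightarrow> j < m \<Longrightarrow> p i j * q i j = c"
  shows "form_power m b g n u
    = (1 + c) ^ n *\<^sub>C form_power m (\<lambda>i j. if i < j then b i j else 0) g n u"
proof (induction n arbitrary: u)
  case 0
  then show ?case by (simp add: scaleC_one)
next
  case (Suc n)
  let ?b = "\<lambda>i j. if i < j then b i j else 0"
  let ?G = "form_power m ?b g n"
  have alt': "alternating m q ?G"
    by (rule alternating_form_power[OF alt])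
  have coeff: "b i j - q i j *\<^sub>C b j i = (1 + c) *\<^sub>C b i j" if "i < j" "j < m" for i j
    using pq[OF that] by (simp add: anti[OF that] scaleC_add_left scaleC_one scaleC_scaleC mult.commute)
  have "(\<Sum>i<m. \<Sum>j<m. b i j * ?G (u @ [i, j])) = (\<Sum>j<m. \<Sum>i<j. (1 + c) *\<^sub>C (b i j * ?G (u @ [i, j])))"
    unfolding alternating_pair_sum[OF alt'] by (intro sum.cong refl) (simp add: coeff mult_scaleC_left)
  also have "\<dots> = (1 + c) *\<^sub>C (\<Sum>i<m. \<Sum>j<m. ?b i j * ?G (u @ [i, j]))"
    unfolding alternating_pair_sum[OF alt'] scaleC.scale_sum_right by (intro sum.cong refl) simp
  finally have "(\<Sum>i<m. \<Sum>j<m. b i j * ?G (u @ [i, j]))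
      = (1 + c) *\<^sub>C (\<Sum>i<m. \<Sum>j<m. ?b i j * ?G (u @ [i, j]))" .
  then show ?case
    by (simp add: Suc.IH mult_scaleC_right scaleC_scaleC mult.commute flip: scaleC.scale_sum_right)
qed

text \<open>
  The substitution \<open>\<Sum> c\<^sub>i\<^sub>j x\<^sub>i x\<^sub>j = \<Sum> b\<^sub>k\<^sub>l y\<^sub>k y\<^sub>l\<close> for the \<open>n\<close>-th powers. The left-hand side expands in the
  \<open>y\<^sub>k\<close>, the right-hand side in the \<open>x\<^sub>i\<close>. The prefix \<open>y\<^sub>v\<close> is what the induction needs: the
  coefficients \<open>b\<^sub>k\<^sub>l\<close> of the next factor have to be moved past it, which is where they must commute with
  the entries of \<open>a\<close>.
\<close>

lemma form_power_congruence:
  assumes comm: "\<And>i j k l. i < m \<Longrightarrow> j < m \<Longrightarrow> k < m \<Longrightarrow> l < m \<Longrightarrow> b i j * a k l = a k l * b i j"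
    and c: "\<And>i j. i < m \<Longrightarrow> j < m \<Longrightarrow> c i j = (\<Sum>k<m. \<Sum>l<m. b k l * (a k i * a l j))"
    and "set v \<subseteq> {..<m}"
  shows "form_power m b (\<lambda>v. row_product m a g v u) n v = row_product m a (form_power m c g n) v u"
  using assms(3)
proof (induction n arbitrary: v)
  case 0
  have "form_power m c g 0 = g" by (rule ext) simp
  then show ?case by simp
next
  case (Suc n)
  let ?F = "form_power m c g n"
  have "(\<Sum>k<m. \<Sum>l<m. b k l * row_product m a ?F [k, l] s) = (\<Sum>i<m. \<Sum>j<m. c i j * ?F (s @ [i, j]))" for s
  proof -
    have "(\<Sum>k<m. \<Sum>l<m. b k l * row_product m a ?F [k, l] s)
        = (\<Sum>(k, l)\<in>{..<m} \<times> {..<m}. \<Sum>(i, j)\<in>{..<m} \<times> {..<m}.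
            b k l * (a k i * a l j) * ?F (s @ [i, j]))"
      by (simp add: sum.cartesian_product[symmetric] sum_distrib_left mult.assoc)
    also have "\<dots> = (\<Sum>(i, j)\<in>{..<m} \<times> {..<m}. \<Sum>(k, l)\<in>{..<m} \<times> {..<m}.
            b k l * (a k i * a l j) * ?F (s @ [i, j]))"
      unfolding case_prod_unfold by (rule sum.swap)
    also have "\<dots> = (\<Sum>i<m. \<Sum>j<m. c i j * ?F (s @ [i, j]))"
      by (simp add: sum.cartesian_product[symmetric] c sum_distrib_right)
    finally show ?thesis .
  qed
  then have expand: "form_power m c g (Suc n) = (\<lambda>s. \<Sum>k<m. \<Sum>l<m. b k l * row_product m a ?F [k, l] s)"
    by (simp add: fun_eq_iff)
  have "form_power m b (\<lambda>v. row_product m a g v u) (Suc n) v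
      = (\<Sum>k<m. \<Sum>l<m. b k l * row_product m a (row_product m a ?F [k, l]) v u)"
    using Suc by (simp add: row_product_append[of m a ?F v] del: row_product.simps)
  also have "\<dots> = (\<Sum>k<m. \<Sum>l<m. row_product m a (\<lambda>s. b k l * row_product m a ?F [k, l] s) v u)"
    using Suc.prems comm by (intro sum.cong refl row_product_commute[symmetric]) auto
  also have "\<dots> = row_product m a (form_power m c g (Suc n)) v u"
    unfolding expand row_product_sum ..
  finally show ?case .
qed

text \<open>
  With the upper triangular half of \<open>B\<close> as coefficients, a permutation outside \<open>pfaffian_perms\<close> has a
  zero factor at a pair in decreasing order.
\<close>

lemma pf_q_eq_form_power:
  "pf_q n q B = form_power (2 * n) (\<lambda>i j. if i < j then B $$ (i, j) else 0)
     (\<lambda>w. word_sign (\<lambda>i j. q $$ (i, j)) w *\<^sub>C 1) n []"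
proof -
  let ?b = "\<lambda>i j. if i < j then B $$ (i, j) else 0"
  have "form_power (2 * n) ?b (\<lambda>w. word_sign (\<lambda>i j. q $$ (i, j)) w *\<^sub>C 1) n []
      = (\<Sum>\<sigma> | \<sigma> permutes {0..<2 * n}. q_sign (2 * n) q \<sigma> *\<^sub>C
          (\<Prod>r\<leftarrow>[0..<n]. ?b (map \<sigma> [0..<2 * n] ! (2 * r)) (map \<sigma> [0..<2 * n] ! (2 * r + 1))))"
    by (simp add: form_power_eq_sum_words mult_scaleC_right sum_words_eq_sum_permutations)
  also have "\<dots> = (\<Sum>\<sigma> | \<sigma> permutes {0..<2 * n}. q_sign (2 * n) q \<sigma> *\<^sub>C
          (\<Prod>r\<leftarrow>[0..<n]. ?b (\<sigma> (2 * r)) (\<sigma> (2 * r + 1))))"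
    by (intro sum.cong refl arg_cong[where f = "scaleC _"] arg_cong[where f = prod_list] map_cong) simp_all
  also have "\<dots> = (\<Sum>\<sigma>\<in>pfaffian_perms n. q_sign (2 * n) q \<sigma> *\<^sub>C
          (\<Prod>r\<leftarrow>[0..<n]. ?b (\<sigma> (2 * r)) (\<sigma> (2 * r + 1))))"
  proof (rule sum.mono_neutral_right)
    show "finite {\<sigma>. \<sigma> permutes {0..<2 * n}}"
      by (rule finite_permutations) simp
    have zero: "(\<Prod>r\<leftarrow>[0..<n]. ?b (\<sigma> (2 * r)) (\<sigma> (2 * r + 1))) = 0"
      if "i < n" "\<not> \<sigma> (2 * i) < \<sigma> (2 * i + 1)" for \<sigma> i
    proof -
      have "[0..<n] = [0..<i] @ i # [Suc i..<n]"
        using that(1) upt_add_eq_append[of 0 i "n - i"] by (simp add: upt_conv_Cons)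
      with that(2) show ?thesis by simp
    qed
    show "\<forall>\<sigma>\<in>{\<sigma>. \<sigma> permutes {0..<2 * n}} - pfaffian_perms n. q_sign (2 * n) q \<sigma> *\<^sub>C
          (\<Prod>r\<leftarrow>[0..<n]. ?b (\<sigma> (2 * r)) (\<sigma> (2 * r + 1))) = 0"
    proof
      fix \<sigma> assume "\<sigma> \<in> {\<sigma>. \<sigma> permutes {0..<2 * n}} - pfaffian_perms n"
      then obtain i where i: "i < n" "\<not> \<sigma> (2 * i) < \<sigma> (2 * i + 1)"
        unfolding pfaffian_perms_def by blast
      show "q_sign (2 * n) q \<sigma> *\<^sub>C (\<Prod>r\<leftarrow>[0..<n]. ?b (\<sigma> (2 * r)) (\<sigma> (2 * r + 1))) = 0"
        by (simp only: zero[OF i] scaleC.scale_zero_right)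
    qed
  qed (auto simp: pfaffian_perms_def)
  also have "\<dots> = pf_q n q B"
    unfolding pf_q_def pfaffian_perms_def
    by (intro sum.cong refl arg_cong[where f = "scaleC _"] arg_cong[where f = prod_list] map_cong) simp_all
  finally show ?thesis ..
qed

section \<open>The congruence transformation\<close>

lemma congruence_entry:
  assumes "A \<in> carrier_mat m m" "B \<in> carrier_mat m m" "i < m" "j < m"
    and "\<And>i j k l. i < m \<Longrightarrow> j < m \<Longrightarrow> k < m \<Longrightarrow> l < m \<Longrightarrow>
           B $$ (i, j) * A $$ (k, l) = A $$ (k, l) * (B $$ (i, j) :: 'r::complex_algebra_unital)"
  shows "(transpose_mat A * B * A) $$ (i, j)
    = (\<Sum>k<m. \<Sum>l<m. B $$ (k, l) * (A $$ (k, i) * A $$ (l, j)))"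
proof -
  have "(transpose_mat A * B * A) $$ (i, j)
      = (\<Sum>k<m. \<Sum>l<m. A $$ (k, i) * B $$ (k, l) * A $$ (l, j))"
    using assms(1-4)
    by (simp add: scalar_prod_def atLeast0LessThan sum_distrib_left mult.assoc)
  also have "\<dots> = (\<Sum>k<m. \<Sum>l<m. B $$ (k, l) * (A $$ (k, i) * A $$ (l, j)))"
    using assms(3,5) by (intro sum.cong refl) (simp flip: mult.assoc)
  finally show ?thesis .
qed

text \<open>
  Collecting the terms at \<open>(k, l)\<close> and \<open>(l, k)\<close> gives the coefficient
  \<open>a\<^sub>k\<^sub>i a\<^sub>l\<^sub>j - p\<^sub>k\<^sub>l a\<^sub>l\<^sub>i a\<^sub>k\<^sub>j\<close> of \<open>b\<^sub>k\<^sub>l\<close> for \<open>k < l\<close>. The second four-term relation of a \<open>(p, \<lambda>)\<close>-matrix, multiplied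
  by \<open>p\<^sub>i\<^sub>j\<close>, says that exchanging \<open>i\<close> and \<open>j\<close> in it amounts to the factor \<open>- p\<^sub>i\<^sub>j\<close>.
\<close>

lemma congruence_antisymmetric:
  fixes a b :: "nat \<Rightarrow> nat \<Rightarrow> 'r::complex_algebra_unital" and m :: nat
  assumes anti: "\<And>k l. k < l \<Longrightarrow> l < m \<Longrightarrow> b l k = - (p k l *\<^sub>C b k l)"
    and diag: "\<And>k. k < m \<Longrightarrow> b k k = 0"
    and cross: "\<And>k l. k < l \<Longrightarrow> l < m \<Longrightarrow>
      a k i * a l j - (p k l / p i j) *\<^sub>C (a l j * a k i)
        = p k l *\<^sub>C (a l i * a k j) - (1 / p i j) *\<^sub>C (a k j * a l i)"
    and nz: "p i j \<noteq> 0"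
  shows "(\<Sum>k<m. \<Sum>l<m. b k l * (a k j * a l i))
    = - (p i j *\<^sub>C (\<Sum>k<m. \<Sum>l<m. b k l * (a k i * a l j)))"
proof -
  have half: "(\<Sum>k<m. \<Sum>l<m. b k l * (a k i * a l j))
      = (\<Sum>l<m. \<Sum>k<l. b k l * (a k i * a l j - p k l *\<^sub>C (a l i * a k j)))" for i j
    unfolding sum_square_split
    by (simp add: diag anti right_diff_distrib mult_scaleC_left mult_scaleC_right)
  have coeff: "a k j * a l i - p k l *\<^sub>C (a l j * a k i)
      = - (p i j *\<^sub>C (a k i * a l j - p k l *\<^sub>C (a l i * a k j)))" if "k < l" "l < m" for k l
    using arg_cong[OF cross[OF that], of "\<lambda>x. p i j *\<^sub>C x"] nz
    by (simp add: scaleC.scale_right_diff_distrib scaleC_scaleC scaleC_one algebra_simps)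
  show ?thesis
    unfolding half scaleC.scale_sum_right sum_negf[symmetric]
    by (intro sum.cong refl) (simp add: coeff mult_scaleC_right)
qed

theorem theorem4p3:
  fixes n :: nat
    and p q :: "complex mat"
    and A B C :: "'r::complex_algebra_unital mat"
  assumes "n \<ge> 1"
    and "p_lambda_condition (2 * n) p q"
    and "p_lambda_matrix (2 * n) p q A"
    and "p_antisymmetric (2 * n) p B"
    and "\<And>i j k l. i < 2 * n \<Longrightarrow> j < 2 * n \<Longrightarrow> k < 2 * n \<Longrightarrow> l < 2 * n \<Longrightarrow>
           B $$ (i, j) * A $$ (k, l) = A $$ (k, l) * B $$ (i, j)"
    and "C = transpose_mat A * B * A"
  shows "(\<forall>i j. i < j \<and> j < 2 * n \<longrightarrow> C $$ (j, i) = - (p $$ (i, j) *\<^sub>C C $$ (i, j))) \<and>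
         pf_q n q C = det_q (2 * n) q A * pf_q n q B"
proof -
  let ?m = "2 * n"
  let ?p = "\<lambda>i j. p $$ (i, j)" and ?q = "\<lambda>i j. q $$ (i, j)"
  let ?a = "\<lambda>i j. A $$ (i, j)" and ?b = "\<lambda>i j. B $$ (i, j)" and ?c = "\<lambda>i j. C $$ (i, j)"
  obtain c where c: "c \<noteq> - 1" "\<And>i j. i < j \<Longrightarrow> j < ?m \<Longrightarrow> ?p i j * ?q i j = c"
    using assms(2) by (auto simp: p_lambda_condition_def)
  have nz: "?p i j \<noteq> 0" "?q i j \<noteq> 0" if "i < ?m" "j < ?m" for i j
    using assms(2) that unfolding p_lambda_condition_def parameter_matrix_def
    by (metis mult_zero_left zero_neq_one)+
  have row_relation: "\<forall>i k l. i < ?m \<and> k < l \<and> l < ?m \<longrightarrow>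
      ?a i k * ?a i l = ?q k l *\<^sub>C (?a i l * ?a i k)"
    and cross_relation_q: "\<forall>i j k l. i < j \<and> j < ?m \<and> k < l \<and> l < ?m \<longrightarrow>
      ?a i k * ?a j l - (?q k l / ?q i j) *\<^sub>C (?a j l * ?a i k)
        = ?q k l *\<^sub>C (?a i l * ?a j k) - (1 / ?q i j) *\<^sub>C (?a j k * ?a i l)"
    and cross_relation_p: "\<forall>i j k l. i < j \<and> j < ?m \<and> k < l \<and> l < ?m \<longrightarrow>
      ?a i k * ?a j l - (?p i j / ?p k l) *\<^sub>C (?a j l * ?a i k)
        = ?p i j *\<^sub>C (?a j k * ?a i l) - (1 / ?p k l) *\<^sub>C (?a i l * ?a j k)"
    using assms(3) unfolding p_lambda_matrix_def by - (elim conjE, assumption)+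
  have entry: "?c i j = (\<Sum>k<?m. \<Sum>l<?m. ?b k l * (?a k i * ?a l j))" if "i < ?m" "j < ?m" for i j
    unfolding assms(6) using assms(3,4) that
    by (intro congruence_entry) (auto simp: p_lambda_matrix_def p_antisymmetric_def assms(5))
  have anti_B: "?b j i = - (?p i j *\<^sub>C ?b i j)" if "i < j" "j < ?m" for i j
    using assms(4) that by (auto simp: p_antisymmetric_def)
  have anti_C: "?c j i = - (?p i j *\<^sub>C ?c i j)" if ij: "i < j" "j < ?m" for i j
  proof -
    have i: "i < ?m" using ij by simp
    show ?thesis
      unfolding entry[OF i ij(2)] entry[OF ij(2) i]
    proof (rule congruence_antisymmetric[where p = ?p and b = ?b and a = ?a])
      show "?b l k = - (?p k l *\<^sub>C ?b k l)" if "k < l" "l < ?m" for k l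
        using that by (rule anti_B)
      show "?b k k = 0" if "k < ?m" for k
        using assms(4) that by (simp add: p_antisymmetric_def)
      show "?a k i * ?a l j - (?p k l / ?p i j) *\<^sub>C (?a l j * ?a k i)
          = ?p k l *\<^sub>C (?a l i * ?a k j) - (1 / ?p i j) *\<^sub>C (?a k j * ?a l i)"
        if "k < l" "l < ?m" for k l
        using cross_relation_p that ij by blast
      show "?p i j \<noteq> 0"
        using i ij(2) by (rule nz)
    qed
  qed
  \<comment> \<open>The products formed below all have degree \<open>2 * n\<close>, where \<open>\<epsilon>\<close> is the top coefficient.\<close>
  define \<epsilon> where "\<epsilon> = (\<lambda>w. word_sign ?q w *\<^sub>C (1 :: 'r))"
  have alt: "alternating ?m ?q \<epsilon>"
    unfolding \<epsilon>_def by (rule alternating_word_sign)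
  have alt_rows: "alternating ?m ?q (\<lambda>v. row_product ?m ?a \<epsilon> v [])"
  proof (rule alternating_rows[where a = ?a, OF alt])
    show "?a k i * ?a k j = ?q i j *\<^sub>C (?a k j * ?a k i)" if "k < ?m" "i < j" "j < ?m" for k i j
      using row_relation that by blast
    show "?a k i * ?a l j - (?q i j / ?q k l) *\<^sub>C (?a l j * ?a k i)
        = ?q i j *\<^sub>C (?a k j * ?a l i) - (1 / ?q k l) *\<^sub>C (?a l i * ?a k j)"
      if "k < l" "l < ?m" "i < j" "j < ?m" for k l i j
      using cross_relation_q that by blast
    show "?q k l \<noteq> 0" if "k < l" "l < ?m" for k l
      using nz that by auto
  qed
  have top: "row_product ?m ?a \<epsilon> v [] = det_q ?m q A * \<epsilon> v" if "set v \<subseteq> {..<?m}" "length v = ?m" for v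
    using alternating_top[OF alt_rows that]
    by (simp add: det_q_eq_row_product \<epsilon>_def mult_scaleC_right)
  have "(1 + c) ^ n *\<^sub>C pf_q n q C = form_power ?m ?c \<epsilon> n []"
    using form_power_upper_half[where p = ?p and b = ?c, OF alt anti_C c(2)]
    by (simp add: pf_q_eq_form_power \<epsilon>_def)
  also have "\<dots> = form_power ?m ?b (\<lambda>v. row_product ?m ?a \<epsilon> v []) n []"
    using form_power_congruence[of ?m ?b ?a ?c "[]" \<epsilon> "[]" n] entry assms(5) by simp
  also have "\<dots> = form_power ?m ?b (\<lambda>v. det_q ?m q A * \<epsilon> v) n []"
    by (rule form_power_cong) (simp add: top)
  also have "\<dots> = det_q ?m q A * form_power ?m ?b \<epsilon> n []"
    using assms(5) by (intro form_power_mult_left det_q_commute) auto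
  also have "form_power ?m ?b \<epsilon> n [] = (1 + c) ^ n *\<^sub>C pf_q n q B"
    using form_power_upper_half[where p = ?p and b = ?b, OF alt anti_B c(2)]
    by (simp add: pf_q_eq_form_power \<epsilon>_def)
  finally have "(1 + c) ^ n *\<^sub>C pf_q n q C = (1 + c) ^ n *\<^sub>C (det_q ?m q A * pf_q n q B)"
    by (simp add: mult_scaleC_right)
  moreover have "1 + c \<noteq> 0"
    using c(1) by (metis add_eq_0_iff)
  ultimately have "pf_q n q C = det_q ?m q A * pf_q n q B"
    using scaleC_cancel by (metis power_not_zero)
  with anti_C show ?thesis by blast
qed

end
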